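(* Let $a>0$, $\lambda\in\mathbb{R}_+$, and let $c\in\mathbb{R}$ be such that $\psi^{(a)}$ has no points of increase in the interval $(c,c+1)$. For every $n\ge 1$ the Sobolev-type Charlier polynomials satisfy the three term recurrence relation $$Q_{n+1}^{\lambda}(x)=\tilde{\beta}(x;n)\,Q_{n}^{\lambda}(x)+\tilde{\gamma}(x;n)\,Q_{n-1}^{\lambda}(x),$$ with rational coefficients $$\tilde{\beta}(x;n)=\frac{\Xi_{2}(x;n)+\Theta_{1}(x;n+1)}{\Theta_{2}(x;n+1)},\qquad \tilde{\gamma}(x;n)=-\frac{\Xi_{1}(x;n)}{\Theta_{2}(x;n+1)}.$$
   Context: Let $a>0$ and let $\psi^{(a)}$ be the Poisson distribution, the discrete measure with mass $e^{-a}a^{x}/x!$ at $x=0,1,2,\ldots$. "No points of increase in $(c,c+1)$" means that $(c,c+1)$ contains no nonnegative integer. $\Delta f(x)=f(x+1)-f(x)$. $\{C_n^{(a)}\}_{n\ge0}$ are the monic Charlier polynomials, orthogonal with respect to $\langle p,q\rangle=\int_0^\infty pq\,d\psi^{(a)}$; $C_{-1}^{(a)}=0$, $C_0^{(a)}=1$, $C_{n+1}^{(a)}(x)=(x-n-a)C_n^{(a)}(x)-na\,C_{n-1}^{(a)}(x)$, $\|C_n^{(a)}\|^2=n!a^n$. $\{Q_n^\lambda\}_{n\ge0}$ is the sequence of monic polynomials ($\deg Q_n^\lambda=n$) orthogonal with respect to $\langle p,q\rangle_\lambda=\int_0^\infty pq\,d\psi^{(a)}+\lambda\,\Delta p(c)\,\Delta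 q(c)$. Put $$A_{1}(x;n)=1-\lambda \frac{\Delta Q_{n}^{\lambda }(c)}{\|C_{n-1}^{(a)}\|^{2}}\,\frac{C_{n-1}^{(a)}(c)+(x-c)\Delta C_{n-1}^{(a)}(c)}{(x-c)(x-c-1)},\qquad B_{1}(x;n)=\lambda \frac{\Delta Q_{n}^{\lambda }(c)}{\|C_{n-1}^{(a)}\|^{2}}\,\frac{C_{n}^{(a)}(c)+(x-c)\Delta C_{n}^{(a)}(c)}{(x-c)(x-c-1)},$$ $$C_1(x;n)=A_1(x+1;n)-A_1(x;n)-\tfrac1a B_1(x+1;n),$$ $$D_1(x;n)=nA_1(x+1;n)-B_1(x;n)+\tfrac{x-n+1}{a}B_1(x+1;n),$$ $$A_2(x;n)=\frac{-B_1(x;n-1)}{a(n-1)},\qquad B_2(x;n)=A_1(x;n-1)+\frac{x-n-a+1}{a(n-1)}B_1(x;n-1),$$ $$C_2(x;n)=\frac{aB_1(x;n-1)-a(n-1)A_1(x+1;n-1)-(x-n+2)B_1(x+1;n-1)}{a^2(n-1)},$$ $$D_2(x;n)=\frac{a(n-1)(1-n+x)A_1(x+1;n-1)+a(-1+a+n-x)B_1(x;n-1)}{a^2(n-1)}-A_1(x;n-1)+\frac{[(n-x-2)(n-x-1)-a(1+x)]B_1(x+1;n-1)}{a^2(n-1)},$$ $$\Lambda(x;n)=A_1(x;n)B_2(x;n)-B_1(x;n)A_2(x;n),$$ and for $k=1,2$ $$\Xi_k(x;n)=\frac{C_1(x;n)B_k(x;n)-A_k(x;n)D_1(x;n)}{\Lambda(x;n)},\qquad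 \Theta_k(x;n)=\frac{C_2(x;n)B_k(x;n)-A_k(x;n)D_2(x;n)}{\Lambda(x;n)}.$$ *)

theory Defs
  imports "HOL-Probability.Probability" "HOL-Computational_Algebra.Polynomial"
begin

definition poisson_distribution :: "real \<Rightarrow> real measure" where
  "poisson_distribution a = measure_pmf (map_pmf real (poisson_pmf a))"

definition fwd_diff :: "(real \<Rightarrow> real) \<Rightarrow> real \<Rightarrow> real" where
  "fwd_diff f x = f (x + 1) - f x"

definition charlier_ip :: "real \<Rightarrow> real poly \<Rightarrow> real poly \<Rightarrow> real" where
  "charlier_ip a p q = (LINT x:{0..}|poisson_distribution a. poly p x * poly q x)"

definition sobolev_ip :: "real \<Rightarrow> real \<Rightarrow> real \<Rightarrow> real poly \<Rightarrow> real poly \<Rightarrow> real" where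
  "sobolev_ip a lam c p q =
     charlier_ip a p q + lam * fwd_diff (poly p) c * fwd_diff (poly q) c"

definition monic_orthogonal ::
  "(real poly \<Rightarrow> real poly \<Rightarrow> real) \<Rightarrow> (nat \<Rightarrow> real poly) \<Rightarrow> bool" where
  "monic_orthogonal ip P \<longleftrightarrow>
     (\<forall>n. degree (P n) = n \<and> lead_coeff (P n) = 1) \<and>
     (\<forall>m n. m \<noteq> n \<longrightarrow> ip (P m) (P n) = 0)"

(* The truncation 0 - 1 = 0 is harmless here: that term has coefficient 0. *)
fun charlier :: "real \<Rightarrow> nat \<Rightarrow> real poly" where
  "charlier a 0 = 1"
| "charlier a (Suc n) =
     [:- real n - a, 1:] * charlier a n - smult (real n * a) (charlier a (n - 1))"

(* The polynomial C_(n-1), with C_(-1) = 0. *)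
definition charlier_pred :: "real \<Rightarrow> nat \<Rightarrow> real poly" where
  "charlier_pred a n = (if n = 0 then 0 else charlier a (n - 1))"

definition rational_on :: "real set \<Rightarrow> (real \<Rightarrow> real) \<Rightarrow> bool" where
  "rational_on S f \<longleftrightarrow>
     (\<exists>p q :: real poly. q \<noteq> 0 \<and> (\<forall>x\<in>S. poly q x \<noteq> 0 \<and> f x = poly p x / poly q x))"

(* The fixed variable Q stands for the sequence of Sobolev-type polynomials. *)

context
  fixes a lam c :: real and Q :: "nat \<Rightarrow> real poly"
begin

definition conn_factor :: "nat \<Rightarrow> real" where
  "conn_factor n =
     lam * (fwd_diff (poly (Q n)) c / charlier_ip a (charlier_pred a n) (charlier_pred a n))"

definition A1 :: "real \<Rightarrow> nat \<Rightarrow> real" where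
  "A1 x n = 1 - conn_factor n *
     ((poly (charlier_pred a n) c + (x - c) * fwd_diff (poly (charlier_pred a n)) c)
      / ((x - c) * (x - c - 1)))"

definition B1 :: "real \<Rightarrow> nat \<Rightarrow> real" where
  "B1 x n = conn_factor n *
     ((poly (charlier a n) c + (x - c) * fwd_diff (poly (charlier a n)) c)
      / ((x - c) * (x - c - 1)))"

definition C1 :: "real \<Rightarrow> nat \<Rightarrow> real" where
  "C1 x n = A1 (x + 1) n - A1 x n - 1 / a * B1 (x + 1) n"

definition D1 :: "real \<Rightarrow> nat \<Rightarrow> real" where
  "D1 x n = real n * A1 (x + 1) n - B1 x n + (x - real n + 1) / a * B1 (x + 1) n"

(* The coefficients with index 2 express Q_(n-1) and its forward difference through C_n and
   C_(n-1), and have the factor n - 1 in a denominator.  For n = 1, A2 and B2 contain 0 / 0: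
   Q_0 is constant, so B1 x 0 = 0 and A1 x 0 = 1.  The convention 0 / 0 = 0 then yields
   A2 x 1 = 0 and B2 x 1 = 1, which is the correct connection Q_0 = 0 * C_1 + 1 * C_0.
   C2 and D2 are only meaningful for n \<ge> 2. *)

definition A2 :: "real \<Rightarrow> nat \<Rightarrow> real" where
  "A2 x n = - B1 x (n - 1) / (a * (real n - 1))"

definition B2 :: "real \<Rightarrow> nat \<Rightarrow> real" where
  "B2 x n = A1 x (n - 1) + (x - real n - a + 1) / (a * (real n - 1)) * B1 x (n - 1)"

definition C2 :: "real \<Rightarrow> nat \<Rightarrow> real" where
  "C2 x n =
     (a * B1 x (n - 1) - a * (real n - 1) * A1 (x + 1) (n - 1)
       - (x - real n + 2) * B1 (x + 1) (n - 1))
     / (a\<^sup>2 * (real n - 1))"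

definition D2 :: "real \<Rightarrow> nat \<Rightarrow> real" where
  "D2 x n =
     (a * (real n - 1) * (1 - real n + x) * A1 (x + 1) (n - 1)
       + a * (- 1 + a + real n - x) * B1 x (n - 1)) / (a\<^sup>2 * (real n - 1))
     - A1 x (n - 1)
     + ((real n - x - 2) * (real n - x - 1) - a * (1 + x)) * B1 (x + 1) (n - 1)
       / (a\<^sup>2 * (real n - 1))"

definition Lam :: "real \<Rightarrow> nat \<Rightarrow> real" where
  "Lam x n = A1 x n * B2 x n - B1 x n * A2 x n"

definition Xi1 :: "real \<Rightarrow> nat \<Rightarrow> real" where
  "Xi1 x n = (C1 x n * B1 x n - A1 x n * D1 x n) / Lam x n"

definition Xi2 :: "real \<Rightarrow> nat \<Rightarrow> real" where
  "Xi2 x n = (C1 x n * B2 x n - A2 x n * D1 x n) / Lam x n"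

definition Theta1 :: "real \<Rightarrow> nat \<Rightarrow> real" where
  "Theta1 x n = (C2 x n * B1 x n - A1 x n * D2 x n) / Lam x n"

definition Theta2 :: "real \<Rightarrow> nat \<Rightarrow> real" where
  "Theta2 x n = (C2 x n * B2 x n - A2 x n * D2 x n) / Lam x n"

definition rec_beta :: "real \<Rightarrow> nat \<Rightarrow> real" where
  "rec_beta x n = (Xi2 x n + Theta1 x (n + 1)) / Theta2 x (n + 1)"

definition rec_gamma :: "real \<Rightarrow> nat \<Rightarrow> real" where
  "rec_gamma x n = - (Xi1 x n / Theta2 x (n + 1))"

(* The points x at which no x-dependent denominator in the formulas for rec_beta x n and
   rec_gamma x n vanishes; since A1 and B1 are evaluated at x and x + 1, their denominators
   exclude c - 1, c and c + 1. *)
definition rec_domain :: "nat \<Rightarrow> real set" where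
  "rec_domain n =
     {x. x \<notin> {c - 1, c, c + 1} \<and> Lam x n \<noteq> 0 \<and> Lam x (n + 1) \<noteq> 0 \<and> Theta2 x (n + 1) \<noteq> 0}"

end

end

(* Orthogonality expands Q_n in Charlier polynomials with a kernel-type correction proportional to
   the forward difference of Q_n at c; the Christoffel-Darboux formula then writes Q_n and its forward
   difference as rational combinations of two consecutive Charlier polynomials.  Inverting these
   2x2 systems gives two expressions for the forward difference of Q_n, one through Q_n, Q_(n-1) and
   one through Q_(n+1), Q_n; equating them is the recurrence.

   No denominator vanishes identically: as x tends to infinity, Lam x (n + 1) tends to
   1 + kappa_n / (a n), and the numerator of Theta2 x (n + 1) tends, up to the factor -1 / (a n), to
   n + kappa_n / a, where kappa_n >= 0 because the forward differences of Q_n and C_n at c have the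
   same sign. *)

theory Submission
  imports Defs "HOL-Real_Asymp.Real_Asymp"
begin

section \<open>Charlier polynomials\<close>

lemma poisson_weight_Suc:
  fixes a :: real
  shows "a ^ Suc k / fact (Suc k) * (real (Suc k) * y) = a * (a ^ k / fact k * y)"
  by (simp add: divide_simps del: of_nat_Suc)

text \<open>Induction on the degree, writing p = b + x q. The part b is an exponential series; in
  the part x q the factor k cancels against k!, so an index shift leaves a times the series of q(x +
  1), whose degree is below that of p.\<close>

lemma summable_poisson_poly:
  fixes a :: real
  shows "summable (\<lambda>k. \<bar>a ^ k / fact k * poly p (real k)\<bar>)"
proof (induction "degree p" arbitrary: p rule: less_induct)
  case less
  obtain b q where p: "p = pCons b q" by (cases p)
  have "summable (\<lambda>k. \<bar>a ^ k / fact k * (real k * poly q (real k))\<bar>)"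
  proof (cases "q = 0")
    case False
    then have "degree (pcompose q [:1, 1:]) < degree p"
      using degree_pcompose[of q "[:1, 1:]"] by (simp add: p)
    from summable_mult[OF less[OF this], of "\<bar>a\<bar>"]
    have "summable (\<lambda>k. \<bar>a ^ Suc k / fact (Suc k) * (real (Suc k) * poly q (real (Suc k)))\<bar>)"
      unfolding poisson_weight_Suc by (simp add: poly_pcompose abs_mult)
    then show ?thesis by (subst (asm) summable_Suc_iff)
  qed simp
  moreover have "summable (\<lambda>k. \<bar>a ^ k / fact k * b\<bar>)"
    using summable_mult2[OF summable_exp[of "\<bar>a\<bar>"], of "\<bar>b\<bar>"]
    by (simp add: abs_mult power_abs field_simps)
  ultimately have "summable (\<lambda>k. \<bar>a ^ k / fact k * b\<bar>
      + \<bar>a ^ k / fact k * (real k * poly q (real k))\<bar>)"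
    by (rule summable_add[rotated])
  then show ?case
    by (rule summable_comparison_test'[where N = 0])
       (auto simp: p distrib_left intro: order_trans[OF abs_triangle_ineq])
qed

text \<open>The measure is the image of a distribution on the naturals, so the integral is one
  against counting measure with a density; absolute summability supplies the integrability that
  turns it into a series.\<close>

lemma charlier_ip_eq_suminf:
  assumes "a > 0"
  shows "charlier_ip a p q = (\<Sum>k. exp (- a) * (a ^ k / fact k * poly (p * q) (real k)))"
proof -
  have pmf: "pmf (poisson_pmf a) k = exp (- a) * (a ^ k / fact k)" for k
    using assms by (simp add: field_simps)
  have "summable (\<lambda>k. exp (- a) * \<bar>a ^ k / fact k * poly (p * q) (real k)\<bar>)"
    by (intro summable_mult summable_poisson_poly)
  then have "integrable (count_space UNIV)
      (\<lambda>k. exp (- a) * (a ^ k / fact k * poly (p * q) (real k)))"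
    by (simp add: integrable_count_space_nat_iff abs_mult del: poly_mult)
  moreover have "charlier_ip a p q
      = (\<integral>k. poly p (real k) * poly q (real k) \<partial>measure_pmf (poisson_pmf a))"
    by (simp add: charlier_ip_def poisson_distribution_def set_lebesgue_integral_def)
  moreover have "\<dots> = (\<integral>k. exp (- a) * (a ^ k / fact k * poly (p * q) (real k)) \<partial>count_space UNIV)"
    by (subst measure_pmf_eq_density, subst integral_density) (use assms in \<open>auto simp: mult_ac\<close>)
  ultimately show ?thesis by (simp add: integral_count_space_nat)
qed

lemma charlier_ip_commute: "charlier_ip a p q = charlier_ip a q p"
  by (simp add: charlier_ip_def mult.commute)

text \<open>Reduces the bilinear form to the linear functional L(p) =
  \<open>charlier_ip a p 1\<close>, on which the shift identity acts.\<close>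

lemma charlier_ip_mult_1: "charlier_ip a p q = charlier_ip a (p * q) 1"
  by (simp add: charlier_ip_def)

lemma summable_poisson_poly': "summable (\<lambda>k. exp (- a) * (a ^ k / fact k * poly p (real k)))"
  for a :: real
  by (intro summable_mult summable_rabs_cancel[OF summable_poisson_poly])

lemma charlier_ip_add_left:
  assumes "a > 0"
  shows "charlier_ip a (p + p') q = charlier_ip a p q + charlier_ip a p' q"
  unfolding charlier_ip_eq_suminf[OF assms]
  by (subst suminf_add[OF summable_poisson_poly' summable_poisson_poly'])
     (simp add: algebra_simps)

lemma charlier_ip_smult_left: "charlier_ip a (smult b p) q = b * charlier_ip a p q"
  by (simp add: charlier_ip_def mult.assoc)

lemma charlier_ip_smult_right: "charlier_ip a p (smult b q) = b * charlier_ip a p q"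
  by (metis charlier_ip_commute charlier_ip_smult_left)

lemma charlier_ip_diff_left:
  assumes "a > 0"
  shows "charlier_ip a (p - p') q = charlier_ip a p q - charlier_ip a p' q"
  using charlier_ip_add_left[OF assms, of p "smult (- 1) p'" q] charlier_ip_smult_left[of a "- 1" p' q]
  by simp

lemma charlier_ip_sum_left:
  assumes "a > 0"
  shows "charlier_ip a (\<Sum>k\<in>A. f k) q = (\<Sum>k\<in>A. charlier_ip a (f k) q)"
  by (induction A rule: infinite_finite_induct)
     (simp_all add: charlier_ip_add_left[OF assms] charlier_ip_smult_left[of a 0 0, simplified])

text \<open>The Stein-Chen identity of the Poisson law: the factor x kills the term k = 0 and lowers
  the factorial in all others.\<close>

lemma charlier_ip_shift:
  assumes "a > 0"
  shows "charlier_ip a ([:0, 1:] * p) 1 = a * charlier_ip a (pcompose p [:1, 1:]) 1"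
proof -
  let ?f = "\<lambda>k. exp (- a) * (a ^ k / fact k * poly ([:0, 1:] * p * 1) (real k))"
  have "suminf ?f = (\<Sum>k. ?f (Suc k))"
    using suminf_split_head[OF summable_poisson_poly', of a "[:0, 1:] * p * 1"] by simp
  also have "\<dots> = (\<Sum>k. a * (exp (- a) * (a ^ k / fact k * poly (pcompose p [:1, 1:] * 1) (real k))))"
  proof (rule suminf_cong)
    fix k
    have "poly ([:0, 1:] * p * 1) (real (Suc k)) = real (Suc k) * poly p (real (Suc k))" by simp
    then show "?f (Suc k) = a * (exp (- a) * (a ^ k / fact k * poly (pcompose p [:1, 1:] * 1) (real k)))"
      by (simp only: poisson_weight_Suc) (simp add: poly_pcompose)
  qed
  also have "\<dots> = a * (\<Sum>k. exp (- a) * (a ^ k / fact k * poly (pcompose p [:1, 1:] * 1) (real k)))"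
    by (rule suminf_mult[OF summable_poisson_poly'])
  finally show ?thesis by (simp only: charlier_ip_eq_suminf[OF assms])
qed

section \<open>Charlier polynomials: lowering relation, orthogonality, Christoffel-Darboux
  formula\<close>

lemma poly_charlier_Suc:
  "poly (charlier a (Suc n)) x =
     (x - real n - a) * poly (charlier a n) x - real n * a * poly (charlier a (n - 1)) x"
  by (simp add: algebra_simps)

text \<open>The lowering relation: the forward difference of C_n is n C_(n-1). The recurrence at x
  and at x + 1, with the hypothesis for the two preceding indices, reduces it to algebra. At n = 0
  the truncated index has coefficient 0.\<close>

lemma poly_charlier_shift:
  "poly (charlier a n) (x + 1) = poly (charlier a n) x + real n * poly (charlier a (n - 1)) x"
proof (induction n rule: less_induct)
  case (less n)
  show ?case
  proof (cases n)
    case (Suc m)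
    have IH: "poly (charlier a m) (x + 1) = poly (charlier a m) x + real m * poly (charlier a (m - 1)) x"
      using less Suc by simp
    show ?thesis
    proof (cases m)
      case (Suc k)
      have IH': "poly (charlier a k) (x + 1) = poly (charlier a k) x + real k * poly (charlier a (k - 1)) x"
        using less \<open>n = Suc m\<close> Suc by simp
      show ?thesis
        using poly_charlier_Suc[of a "Suc k" x] poly_charlier_Suc[of a "Suc k" "x + 1"]
          IH[unfolded \<open>m = Suc k\<close>] IH' poly_charlier_Suc[of a k x]
        unfolding \<open>n = Suc m\<close> \<open>m = Suc k\<close> diff_Suc_1 of_nat_Suc
        by algebra
    qed (simp add: \<open>n = Suc m\<close>)
  qed simp
qed

lemma pcompose_charlier_shift:
  "pcompose (charlier a n) [:1, 1:] = charlier a n + smult (real n) (charlier a (n - 1))"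
  by (rule poly_eq_poly_eq_iff[THEN iffD1], rule ext)
     (simp add: poly_pcompose add.commute[of 1] poly_charlier_shift)

lemma degree_charlier_aux: "degree (charlier a n) = n \<and> lead_coeff (charlier a n) = 1"
proof (induction n rule: less_induct)
  case (less n)
  show ?case
  proof (cases n)
    case (Suc m)
    let ?p = "[:- real m - a, 1:] * charlier a m" and ?r = "smult (real m * a) (charlier a (m - 1))"
    have "degree (charlier a m) = m \<and> lead_coeff (charlier a m) = 1"
      by (rule less) (simp add: Suc)
    then have IH: "degree (charlier a m) = m" "lead_coeff (charlier a m) = 1"
      by blast+
    have nz: "charlier a m \<noteq> 0" using IH(2) by (metis coeff_0 zero_neq_one)
    have lc: "coeff (charlier a m) m = 1" using IH(2) unfolding IH(1) .
    have p: "degree ?p = Suc m"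
      using IH(1) nz by (subst degree_mult_eq) auto
    have lp: "lead_coeff ?p = 1"
      by (subst lead_coeff_mult) (simp add: IH(1) lc)
    have r: "degree ?r < Suc m"
      using less[of "m - 1"] Suc by (cases m) (auto intro: le_less_trans[OF degree_smult_le])
    have eq: "charlier a n = ?p + - ?r" by (simp add: Suc)
    have "degree (charlier a n) = Suc m" unfolding eq
      using r p by (subst degree_add_eq_left) auto
    moreover have "coeff ?r (Suc m) = 0" using r by (rule coeff_eq_0)
    then have "coeff (charlier a n) (Suc m) = 1"
      using lp unfolding eq p coeff_add coeff_minus by simp
    ultimately show ?thesis by (simp only: Suc)
  qed simp
qed

lemma degree_charlier: "degree (charlier a n) = n"
  and lead_coeff_charlier: "lead_coeff (charlier a n) = 1"
  using degree_charlier_aux by blast+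

text \<open>Summation by parts. In the recurrence for C_(n+1), the term x C_n p is treated by the
  shift identity and the lowering relation; the induction hypothesis then cancels everything that
  contains C_(n-1).\<close>

lemma charlier_ip_Suc:
  assumes "a > 0"
  shows "charlier_ip a (charlier a (Suc n)) p
    = a * charlier_ip a (charlier a n) (pcompose p [:1, 1:] - p)"
proof (induction n arbitrary: p rule: less_induct)
  case (less n)
  let ?L = "\<lambda>r. charlier_ip a r 1" and ?p' = "pcompose p [:1, 1:]"
  let ?C = "charlier a n" and ?C' = "charlier a (n - 1)"
  note L = charlier_ip_add_left[OF assms] charlier_ip_diff_left[OF assms] charlier_ip_smult_left
  have eq: "charlier a (Suc n) * p
      = [:0, 1:] * (?C * p) - smult (real n + a) (?C * p) - smult (real n * a) (?C' * p)"
    by (simp add: algebra_simps smult_add_left smult_diff_left)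
  have "?L (charlier a (Suc n) * p)
      = ?L ([:0, 1:] * (?C * p)) - (real n + a) * ?L (?C * p) - real n * a * ?L (?C' * p)"
    unfolding eq by (simp only: L)
  also have "?L ([:0, 1:] * (?C * p)) = a * ?L ((?C + smult (real n) ?C') * ?p')"
    unfolding charlier_ip_shift[OF assms] by (simp only: pcompose_mult pcompose_charlier_shift)
  also have "\<dots> = a * ?L (?C * ?p') + a * real n * ?L (?C' * ?p')"
    by (simp only: distrib_right mult_smult_left L) (simp add: algebra_simps)
  finally have main: "?L (charlier a (Suc n) * p) = a * ?L (?C * ?p') + a * real n * ?L (?C' * ?p')
      - (real n + a) * ?L (?C * p) - real n * a * ?L (?C' * p)" .
  \<comment> \<open>This is the induction hypothesis at n - 1; the factor n makes the case n = 0,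
    where there is none, trivial.\<close>
  have "real n * ?L (?C * p) = real n * (a * (?L (?C' * ?p') - ?L (?C' * p)))"
  proof (cases n)
    case (Suc m)
    have "?L (?C * p) = a * ?L (?C' * (?p' - p))"
      using less[of m p] Suc
      by (simp only: lessI diff_Suc_1 charlier_ip_mult_1[of a "charlier a _"] simp_thms)
    then show ?thesis by (simp only: right_diff_distrib L)
  qed simp
  with main have "?L (charlier a (Suc n) * p) = a * (?L (?C * ?p') - ?L (?C * p))"
    by algebra
  also have "\<dots> = a * ?L (?C * (?p' - p))"
    by (simp only: right_diff_distrib L)
  finally show ?case by (simp only: charlier_ip_mult_1[of a "charlier a _"])
qed

text \<open>Summation by parts followed by the lowering relation decreases both indices by one at
  the cost of a factor a n. What remains is C_0 against itself, of total mass 1, or C_0 against a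
  higher polynomial, where the forward difference of C_0 vanishes.\<close>

lemma charlier_ip_charlier:
  assumes "a > 0"
  shows "charlier_ip a (charlier a m) (charlier a n) = (if m = n then fact n * a ^ n else 0)"
proof -
  have Suc_0: "charlier_ip a (charlier a (Suc m)) (charlier a 0) = 0" for m
    using charlier_ip_smult_right[of a "charlier a m" 0 0]
    by (simp add: charlier_ip_Suc[OF assms] pcompose_1 del: charlier.simps(2))
  have zero_zero: "charlier_ip a (charlier a 0) (charlier a 0) = 1"
    by (simp add: charlier_ip_def poisson_distribution_def set_lebesgue_integral_def
        vimage_def measure_pmf.prob_space[of "poisson_pmf a", simplified])
  show ?thesis
  proof (induction m arbitrary: n)
    case 0
    then show ?case
    proof (cases n)
      case (Suc k)
      then show ?thesis by (subst charlier_ip_commute) (simp add: Suc_0 del: charlier.simps)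
    qed (simp add: zero_zero del: charlier.simps)
  next
    case (Suc m)
    then show ?case
    proof (cases n)
      case (Suc k)
      have "pcompose (charlier a n) [:1, 1:] - charlier a n = smult (real n) (charlier a k)"
        by (simp add: pcompose_charlier_shift Suc del: charlier.simps)
      then have "charlier_ip a (charlier a (Suc m)) (charlier a n)
          = a * (real n * charlier_ip a (charlier a m) (charlier a k))"
        by (simp only: charlier_ip_Suc[OF assms] charlier_ip_smult_right)
      then show ?thesis using Suc.IH[of k] Suc by (simp del: charlier.simps)
    qed (simp add: Suc_0 del: charlier.simps)
  qed
qed

text \<open>The squared norms satisfy N_n = n a N_(n-1). With this ratio cleared, adding the term k
  = n turns the numerator for n into the one for n + 1 by the three term recurrence.\<close>

lemma charlier_christoffel_darboux:
  assumes "a > 0" "n \<ge> 1"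
  shows "(x - y) * (\<Sum>k<n. poly (charlier a k) x * poly (charlier a k) y / (fact k * a ^ k))
    = (poly (charlier a n) x * poly (charlier a (n - 1)) y
       - poly (charlier a (n - 1)) x * poly (charlier a n) y) / (fact (n - 1) * a ^ (n - 1))"
  using assms(2)
proof (induction n rule: nat_induct_at_least)
  case (Suc n)
  define X X' Y Y' where "X = poly (charlier a n) x" "X' = poly (charlier a (n - 1)) x"
    "Y = poly (charlier a n) y" "Y' = poly (charlier a (n - 1)) y"
  note defs = this
  define r N N' where "r = real n * a" "N = fact n * a ^ n" "N' = fact (n - 1) * a ^ (n - 1)"
  have N: "N = r * N'" "r \<noteq> 0" "N' \<noteq> 0"
    using Suc.hyps assms(1) by (cases n; simp add: r_N_N'_def)+
  have "(x - y) * (\<Sum>k<Suc n. poly (charlier a k) x * poly (charlier a k) y / (fact k * a ^ k))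
      = (X * Y' - X' * Y) / N' + (x - y) * (X * Y) / N"
    using Suc.IH by (simp add: distrib_left defs r_N_N'_def del: charlier.simps)
  also have "\<dots> = (((x - real n - a) * X - r * X') * Y - X * ((y - real n - a) * Y - r * Y')) / N"
    using N by (simp add: field_simps)
  finally show ?case
    by (simp only: poly_charlier_Suc defs r_N_N'_def diff_Suc_1)
qed (simp add: algebra_simps)

section \<open>The connection formula\<close>

text \<open>The condition on coefficients expresses degree below n and also covers n = 0, where it
  forces p = 0. Subtracting a multiple of the top basis element lowers n.\<close>

lemma poly_in_span_monic_basis:
  fixes P :: "nat \<Rightarrow> 'a :: field poly"
  assumes "\<And>k. degree (P k) = k" "\<And>k. lead_coeff (P k) = 1" and "\<forall>i\<ge>n. coeff p i = 0"
  shows "\<exists>\<alpha>. p = (\<Sum>k<n. smult (\<alpha> k) (P k))"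
  using assms(3)
proof (induction n arbitrary: p)
  case 0 then show ?case by (simp add: poly_eq_iff)
next
  case (Suc n)
  let ?r = "p - smult (coeff p n) (P n)"
  have "coeff ?r i = 0" if "i \<ge> n" for i
    using that assms(1,2)[of n] Suc.prems by (cases "i = n") (auto simp: coeff_eq_0)
  with Suc.IH obtain \<alpha> where \<alpha>: "?r = (\<Sum>k<n. smult (\<alpha> k) (P k))" by blast
  have "p = (\<Sum>k<Suc n. smult ((\<alpha>(n := coeff p n)) k) (P k))"
    using \<alpha> by (simp add: algebra_simps)
  then show ?case by blast
qed

lemma fwd_diff_poly_diff: "fwd_diff (poly (p - q)) x = fwd_diff (poly p) x - fwd_diff (poly q) x"
  and fwd_diff_poly_smult: "fwd_diff (poly (smult b p)) x = b * fwd_diff (poly p) x"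
  and fwd_diff_poly_sum: "fwd_diff (poly (\<Sum>k\<in>A. f k)) x = (\<Sum>k\<in>A. fwd_diff (poly (f k)) x)"
  by (simp_all add: fwd_diff_def algebra_simps poly_sum sum_subtractf)

text \<open>The coefficients with index 2 arise from those with index 1 by substituting
  \<open>C\<^sub>n\<^sub>-\<^sub>1 = ((x - n - a) C\<^sub>n - C\<^sub>n\<^sub>+\<^sub>1) / (a n)\<close>.\<close>

lemma A2_Suc: "A2 a lam c Q x (Suc n) = - B1 a lam c Q x n / (a * real n)"
  and B2_Suc: "B2 a lam c Q x (Suc n) =
    A1 a lam c Q x n + (x - real n - a) / (a * real n) * B1 a lam c Q x n"
  by (simp_all add: A2_def B2_def)

lemma C2_Suc: "a > 0 \<Longrightarrow> n \<ge> 1 \<Longrightarrow> C2 a lam c Q x (Suc n) = - D1 a lam c Q x n / (a * real n)"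
  and D2_Suc: "a > 0 \<Longrightarrow> n \<ge> 1 \<Longrightarrow> D2 a lam c Q x (Suc n) =
    C1 a lam c Q x n + (x - real n - a) / (a * real n) * D1 a lam c Q x n"
  by (simp_all add: C2_def D2_def C1_def D1_def field_simps power2_eq_square)

section \<open>Sobolev-type polynomials expanded in Charlier polynomials\<close>

context
  fixes a lam c :: real and Q :: "nat \<Rightarrow> real poly"
  assumes a: "a > 0" and lam: "lam \<ge> 0" and Q: "monic_orthogonal (sobolev_ip a lam c) Q"
begin

lemma degree_Q: "degree (Q n) = n"
  and lead_coeff_Q: "lead_coeff (Q n) = 1"
  and orthogonal_Q: "m \<noteq> n \<Longrightarrow> sobolev_ip a lam c (Q m) (Q n) = 0"
  using Q unfolding monic_orthogonal_def by blast+

text \<open>The Q_k with k < n span the polynomials of degree below n, so orthogonality extends to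
  them by linearity.\<close>

lemma sobolev_ip_Q_eq_0:
  assumes "\<forall>i\<ge>n. coeff p i = 0"
  shows "sobolev_ip a lam c p (Q n) = 0"
proof -
  obtain \<alpha> where p: "p = (\<Sum>k<n. smult (\<alpha> k) (Q k))"
    using poly_in_span_monic_basis[of Q, OF degree_Q lead_coeff_Q assms] by blast
  have "sobolev_ip a lam c p (Q n) = (\<Sum>k<n. \<alpha> k * sobolev_ip a lam c (Q k) (Q n))"
    by (simp add: p sobolev_ip_def charlier_ip_sum_left[OF a] charlier_ip_smult_left
        fwd_diff_poly_sum fwd_diff_poly_smult sum_distrib_left sum_distrib_right
        algebra_simps sum.distrib)
  then show ?thesis by (simp add: orthogonal_Q)
qed

text \<open>Expand Q_n - C_n, of degree below n, in the C_k. For j < n, Sobolev orthogonality of Q_n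
  and C_j makes their Charlier inner product minus \<open>lam\<close> times the product of their
  forward differences at c. The sum is thus the forward difference at c, in one variable, of the
  Christoffel-Darboux kernel.\<close>

lemma Q_eq_charlier_sum:
  "Q n = charlier a n - smult (lam * fwd_diff (poly (Q n)) c)
     (\<Sum>k<n. smult (fwd_diff (poly (charlier a k)) c / (fact k * a ^ k)) (charlier a k))"
proof -
  have "coeff (Q n - charlier a n) i = 0" if "i \<ge> n" for i
    using that lead_coeff_Q[of n] degree_Q[of n] degree_charlier[of a n] lead_coeff_charlier[of a n]
    by (cases "i = n") (auto simp: coeff_eq_0 simp del: charlier.simps)
  then obtain \<alpha> where \<alpha>: "Q n - charlier a n = (\<Sum>k<n. smult (\<alpha> k) (charlier a k))"
    using poly_in_span_monic_basis[of "charlier a", OF degree_charlier lead_coeff_charlier, of n]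
    by blast
  have "\<alpha> j = - (lam * fwd_diff (poly (Q n)) c) * (fwd_diff (poly (charlier a j)) c / (fact j * a ^ j))"
    if j: "j < n" for j
  proof -
    have "\<alpha> j * (fact j * a ^ j) = charlier_ip a (Q n - charlier a n) (charlier a j)"
      unfolding \<alpha> charlier_ip_sum_left[OF a] charlier_ip_smult_left charlier_ip_charlier[OF a]
      using j by (simp add: if_distrib[of "(*) _"] cong: if_cong)
    also have "\<dots> = charlier_ip a (charlier a j) (Q n)"
      using j by (simp add: charlier_ip_diff_left[OF a] charlier_ip_charlier[OF a]
          charlier_ip_commute[of a "Q n"] del: charlier.simps)
    also have "\<dots> = - (lam * fwd_diff (poly (Q n)) c) * fwd_diff (poly (charlier a j)) c"
      using sobolev_ip_Q_eq_0[of n "charlier a j"] j degree_charlier[of a j]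
      by (simp add: sobolev_ip_def coeff_eq_0 algebra_simps del: charlier.simps)
    finally show ?thesis using a by (simp add: field_simps)
  qed
  then have sum: "Q n - charlier a n = (\<Sum>k<n. smult (- (lam * fwd_diff (poly (Q n)) c))
      (smult (fwd_diff (poly (charlier a k)) c / (fact k * a ^ k)) (charlier a k)))"
    unfolding \<alpha> by (intro sum.cong) (simp_all del: charlier.simps)
  have smult_sum: "(\<Sum>k<n. smult b (f k)) = smult b (\<Sum>k<n. f k)" for b and f :: "nat \<Rightarrow> real poly"
    by (simp add: poly_eq_iff coeff_sum sum_distrib_left)
  have "p = q - smult b r" if "p - q = smult (- b) r" for b and p q r :: "real poly"
    using that by (simp add: algebra_simps)
  from this[OF sum[unfolded smult_sum]] show ?thesis .
qed

text \<open>Forward differences at c in the expansion show that the one of C_n is 1 +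
  \<open>lam\<close> S times the one of Q_n, where S is a nonnegative sum of weighted
  squares.\<close>

lemma fwd_diff_Q_sign: "fwd_diff (poly (Q n)) c * fwd_diff (poly (charlier a n)) c \<ge> 0"
proof -
  define S where "S = (\<Sum>k<n. (fwd_diff (poly (charlier a k)) c)\<^sup>2 / (fact k * a ^ k))"
  have S: "S \<ge> 0" unfolding S_def using a by (intro sum_nonneg) simp
  have "fwd_diff (poly (Q n)) c = fwd_diff (poly (charlier a n)) c - lam * fwd_diff (poly (Q n)) c * S"
    using arg_cong[OF Q_eq_charlier_sum[of n], of "\<lambda>p. fwd_diff (poly p) c"]
    by (simp only: fwd_diff_poly_diff fwd_diff_poly_smult fwd_diff_poly_sum S_def)
       (simp add: power2_eq_square)
  then have "fwd_diff (poly (Q n)) c * fwd_diff (poly (charlier a n)) c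
      = (fwd_diff (poly (Q n)) c)\<^sup>2 * (1 + lam * S)"
    by (simp add: algebra_simps power2_eq_square)
  then show ?thesis using S lam by simp
qed

lemma charlier_pred_norm_pos: "n \<ge> 1 \<Longrightarrow> charlier_ip a (charlier_pred a n) (charlier_pred a n) > 0"
  using a by (simp add: charlier_pred_def charlier_ip_charlier[OF a] del: charlier.simps)

lemma conn_factor_0: "conn_factor a lam c Q 0 = 0"
proof -
  obtain b where "Q 0 = [:b:]" using degree_Q[of 0] degree_0_id by metis
  then show ?thesis by (simp add: conn_factor_def fwd_diff_def)
qed

text \<open>This is kappa_n \<ge> 0, which later keeps the limits at infinity away from 0.\<close>

lemma conn_factor_sign: "conn_factor a lam c Q n * fwd_diff (poly (charlier a n)) c \<ge> 0"
proof (cases "n \<ge> 1")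
  case True
  have "conn_factor a lam c Q n * fwd_diff (poly (charlier a n)) c =
     lam * (fwd_diff (poly (Q n)) c * fwd_diff (poly (charlier a n)) c)
       / charlier_ip a (charlier_pred a n) (charlier_pred a n)"
    by (simp add: conn_factor_def)
  then show ?thesis
    using lam fwd_diff_Q_sign[of n] charlier_pred_norm_pos[OF True] by simp
next
  case False
  then show ?thesis by (simp add: conn_factor_0 not_le)
qed

text \<open>With x fixed and K the kernel as a function of y, the correction in the expansion is a
  multiple of K(c + 1) - K(c). The Christoffel-Darboux formula expresses both values through C_n and
  C_(n-1), dividing by x - y; hence the two excluded points.\<close>

lemma connection_formula:
  assumes "x \<notin> {c, c + 1}"
  shows "poly (Q n) x = A1 a lam c Q x n * poly (charlier a n) x
    + B1 a lam c Q x n * poly (charlier_pred a n) x"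
proof (cases "n \<ge> 1")
  case False
  \<comment> \<open>For n = 0 both sides are 1: the connection factor and
    \<open>charlier_pred\<close> vanish.\<close>
  moreover have "Q 0 = 1"
    using degree_Q[of 0] lead_coeff_Q[of 0] by (metis degree_0_id one_pCons)
  ultimately show ?thesis
    by (simp add: not_le A1_def B1_def conn_factor_0)
next
  case True
  define N :: real where "N = fact (n - 1) * a ^ (n - 1)"
  have N: "N > 0" "charlier_ip a (charlier_pred a n) (charlier_pred a n) = N"
    using a True by (simp_all add: N_def charlier_pred_def charlier_ip_charlier[OF a] del: charlier.simps)
  let ?C = "\<lambda>k. poly (charlier a k)"
  define K where "K y = (\<Sum>k<n. ?C k x * ?C k y / (fact k * a ^ k))" for y
  define P where "P = charlier a (n - 1)"
  have K: "K y = (?C n x * poly P y - poly P x * ?C n y) / (N * (x - y))" if "x \<noteq> y" for y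
  proof -
    have "(x - y) * K y = (?C n x * poly P y - poly P x * ?C n y) / N"
      using charlier_christoffel_darboux[OF a True, of x y] by (simp only: K_def N_def P_def)
    then show ?thesis using that N(1) by (simp add: eq_divide_eq mult_ac)
  qed
  have "poly (Q n) x = ?C n x - lam * fwd_diff (poly (Q n)) c * (K (c + 1) - K c)"
    using arg_cong[OF Q_eq_charlier_sum[of n], of "\<lambda>p. poly p x"]
    by (simp add: poly_sum K_def fwd_diff_def algebra_simps diff_divide_distrib sum_subtractf
        del: charlier.simps)
  moreover have "K (c + 1) - K c = ((poly P c + (x - c) * fwd_diff (poly P) c) * ?C n x
      - (?C n c + (x - c) * fwd_diff (?C n) c) * poly P x) / (N * ((x - c) * (x - c - 1)))"
  proof -
    have "x - c \<noteq> 0" "x - c - 1 \<noteq> 0" using assms by auto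
    moreover define u where "u = x - c"
    moreover have "x - (c + 1) = u - 1" by (simp add: u_def)
    ultimately show ?thesis
      using N(1) assms by (simp add: K fwd_diff_def divide_simps del: charlier.simps)
        (simp add: algebra_simps del: charlier.simps)
  qed
  \<comment> \<open>Collects the multiples of X and Y; since division is total, this holds without
    conditions on D.\<close>
  moreover have "X - l * e * ((U * X - V * Y) / (N * D)) = (1 - l * (e / N) * (U / D)) * X + l * (e / N) * (V / D) * Y"
    for X Y U V D l e :: real
    by (simp add: algebra_simps diff_divide_distrib)
  moreover have "charlier_pred a n = P"
    using True by (simp add: charlier_pred_def P_def)
  ultimately show ?thesis
    unfolding A1_def B1_def conn_factor_def N(2) by simp
qed

text \<open>The connection formula is applied at x and at x + 1, hence the further excluded point c
  - 1. The lowering relation moves everything back to x but brings in C_(n-2), which the recurrence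
  eliminates.\<close>

lemma fwd_diff_Q_eq:
  assumes "n \<ge> 1" and x: "x \<notin> {c - 1, c, c + 1}"
  shows "fwd_diff (poly (Q n)) x = C1 a lam c Q x n * poly (charlier a n) x
    + D1 a lam c Q x n * poly (charlier_pred a n) x"
proof -
  obtain m where m: "n = Suc m" using assms(1) by (cases n) auto
  define X Y Z where "X = poly (charlier a n) x" "Y = poly (charlier a m) x"
    "Z = poly (charlier a (m - 1)) x"
  note defs = this
  have X: "X = (x - real m - a) * Y - real m * a * Z"
    by (simp only: defs m poly_charlier_Suc)
  have X1: "poly (charlier a n) (x + 1) = X + real n * Y"
    and Y1: "poly (charlier a m) (x + 1) = Y + real m * Z"
    by (simp_all only: defs m poly_charlier_shift diff_Suc_1)
  have "x \<notin> {c, c + 1}" "x + 1 \<notin> {c, c + 1}" using x by auto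
  note conn = this[THEN connection_formula, of n]
  have pred: "charlier_pred a n = charlier a m" by (simp add: charlier_pred_def m)
  define \<alpha> \<alpha>' \<beta> \<beta>' where "\<alpha> = A1 a lam c Q x n" "\<alpha>' = A1 a lam c Q (x + 1) n"
    "\<beta> = B1 a lam c Q x n" "\<beta>' = B1 a lam c Q (x + 1) n"
  note cdefs = this
  have "fwd_diff (poly (Q n)) x = \<alpha>' * (X + real n * Y) + \<beta>' * (Y + real m * Z) - (\<alpha> * X + \<beta> * Y)"
    unfolding fwd_diff_def conn pred X1 Y1 cdefs by (simp only: defs)
  also have "\<dots> = (\<alpha>' - \<alpha> - 1 / a * \<beta>') * X + (real n * \<alpha>' - \<beta> + (x - real n + 1) / a * \<beta>') * Y"
    unfolding X using a by (simp add: m field_simps)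
  finally show ?thesis
    by (simp only: C1_def D1_def pred defs cdefs)
qed

section \<open>Passage to the pair C_(n+1), C_n and elimination of the Charlier polynomials\<close>

lemma charlier_pred_eq:
  "n \<ge> 1 \<Longrightarrow> poly (charlier_pred a n) x =
    ((x - real n - a) * poly (charlier a n) x - poly (charlier a (Suc n)) x) / (a * real n)"
  using a unfolding poly_charlier_Suc charlier_pred_def by (simp del: charlier.simps)

text \<open>The recurrence solved backwards replaces C_(n-1). For n = 0 it cannot be solved, but
  division by 0 yields the coefficients 0 and \<open>A1\<close>, which is right because
  \<open>charlier_pred\<close> is 0 there.\<close>

lemma connection_formula_Suc:
  assumes "x \<notin> {c, c + 1}"
  shows "poly (Q n) x = A2 a lam c Q x (Suc n) * poly (charlier a (Suc n)) x
    + B2 a lam c Q x (Suc n) * poly (charlier a n) x"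
proof (cases "n \<ge> 1")
  case True
  then show ?thesis
    unfolding connection_formula[OF assms, of n] A2_Suc B2_Suc charlier_pred_eq[OF True]
    using a by (simp add: field_simps del: charlier.simps)
next
  case False
  then show ?thesis
    unfolding connection_formula[OF assms, of n] A2_Suc B2_Suc
    by (simp add: not_le charlier_pred_def)
qed

lemma fwd_diff_Q_eq_Suc:
  assumes "n \<ge> 1" "x \<notin> {c - 1, c, c + 1}"
  shows "fwd_diff (poly (Q n)) x = C2 a lam c Q x (Suc n) * poly (charlier a (Suc n)) x
    + D2 a lam c Q x (Suc n) * poly (charlier a n) x"
  unfolding fwd_diff_Q_eq[OF assms] C2_Suc[OF a assms(1)] D2_Suc[OF a assms(1)] charlier_pred_eq[OF assms(1)]
  using a assms(1) by (simp add: field_simps del: charlier.simps)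

text \<open>Cramer's rule for eliminating X and Y; in both applications the determinant is
  \<open>Lam\<close>.\<close>

lemma change_of_basis:
  fixes p q d :: real
  assumes "q = \<alpha> * X + \<beta> * Y" "p = \<gamma> * X + \<delta> * Y" "d = \<kappa> * X + \<mu> * Y" "\<alpha> * \<delta> - \<beta> * \<gamma> \<noteq> 0"
  shows "d = (\<kappa> * \<delta> - \<gamma> * \<mu>) / (\<alpha> * \<delta> - \<beta> * \<gamma>) * q - (\<kappa> * \<beta> - \<alpha> * \<mu>) / (\<alpha> * \<delta> - \<beta> * \<gamma>) * p"
proof -
  have "d * (\<alpha> * \<delta> - \<beta> * \<gamma>) = (\<kappa> * \<delta> - \<gamma> * \<mu>) * q - (\<kappa> * \<beta> - \<alpha> * \<mu>) * p"
    unfolding assms(1-3) by algebra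
  then have "d = ((\<kappa> * \<delta> - \<gamma> * \<mu>) * q - (\<kappa> * \<beta> - \<alpha> * \<mu>) * p) / (\<alpha> * \<delta> - \<beta> * \<gamma>)"
    using assms(4) by (simp add: eq_divide_eq)
  then show ?thesis by (subst (asm) diff_divide_distrib) simp
qed

lemma fwd_diff_Q_eq_Xi:
  assumes "n \<ge> 1" "x \<notin> {c - 1, c, c + 1}" "Lam a lam c Q x n \<noteq> 0"
  shows "fwd_diff (poly (Q n)) x = Xi2 a lam c Q x n * poly (Q n) x - Xi1 a lam c Q x n * poly (Q (n - 1)) x"
proof -
  have "x \<notin> {c, c + 1}" "Suc (n - 1) = n" "charlier_pred a n = charlier a (n - 1)"
    using assms by (auto simp: charlier_pred_def)
  then show ?thesis
    using assms connection_formula[of x n] connection_formula_Suc[of x "n - 1"]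
      fwd_diff_Q_eq[OF assms(1,2)]
    unfolding Xi1_def Xi2_def Lam_def by (intro change_of_basis) simp_all
qed

text \<open>At index n + 1, \<open>A1\<close> and \<open>B1\<close> describe Q_(n+1), while the
  coefficients numbered 2 describe Q_n and its forward difference, all through C_(n+1) and
  C_n.\<close>

lemma fwd_diff_Q_eq_Theta:
  assumes "n \<ge> 1" "x \<notin> {c - 1, c, c + 1}" "Lam a lam c Q x (Suc n) \<noteq> 0"
  shows "fwd_diff (poly (Q n)) x =
    Theta2 a lam c Q x (Suc n) * poly (Q (Suc n)) x - Theta1 a lam c Q x (Suc n) * poly (Q n) x"
proof -
  have x: "x \<notin> {c, c + 1}" using assms by auto
  have "poly (Q (Suc n)) x = A1 a lam c Q x (Suc n) * poly (charlier a (Suc n)) x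
      + B1 a lam c Q x (Suc n) * poly (charlier a n) x"
    using connection_formula[OF x, of "Suc n"] by (simp add: charlier_pred_def del: charlier.simps)
  then show ?thesis
    unfolding Theta1_def Theta2_def Lam_def
    using assms(3)[unfolded Lam_def]
    by (rule change_of_basis[OF _ connection_formula_Suc[OF x] fwd_diff_Q_eq_Suc[OF assms(1,2)]])
qed

lemma three_term_recurrence:
  assumes "n \<ge> 1" "x \<in> rec_domain a lam c Q n"
  shows "poly (Q (n + 1)) x =
    rec_beta a lam c Q x n * poly (Q n) x + rec_gamma a lam c Q x n * poly (Q (n - 1)) x"
proof -
  have "Xi2 a lam c Q x n * poly (Q n) x - Xi1 a lam c Q x n * poly (Q (n - 1)) x
      = Theta2 a lam c Q x (n + 1) * poly (Q (n + 1)) x - Theta1 a lam c Q x (n + 1) * poly (Q n) x"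
    using fwd_diff_Q_eq_Xi[of n x] fwd_diff_Q_eq_Theta[of n x] assms by (simp add: rec_domain_def)
  then show ?thesis
    using assms(2) by (simp add: rec_domain_def rec_beta_def rec_gamma_def field_simps)
qed

end

section \<open>Rationality of the coefficients and behaviour at infinity\<close>

named_theorems rational_intros

lemma rational_on_const [rational_intros]: "rational_on S (\<lambda>x. b)"
  unfolding rational_on_def by (intro exI[of _ "[:b:]"] exI[of _ 1]) simp

lemma rational_on_ident [rational_intros]: "rational_on S (\<lambda>x. x)"
  unfolding rational_on_def by (intro exI[of _ "[:0, 1:]"] exI[of _ 1]) simp

lemma rational_on_mult [rational_intros]:
  assumes "rational_on S f" "rational_on S g"
  shows "rational_on S (\<lambda>x. f x * g x)"
proof -
  obtain p q r s where "q \<noteq> 0" "\<forall>x\<in>S. poly q x \<noteq> 0 \<and> f x = poly p x / poly q x"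
    "s \<noteq> 0" "\<forall>x\<in>S. poly s x \<noteq> 0 \<and> g x = poly r x / poly s x"
    using assms unfolding rational_on_def by metis
  then show ?thesis
    unfolding rational_on_def by (intro exI[of _ "p * r"] exI[of _ "q * s"]) simp
qed

lemma rational_on_add [rational_intros]:
  assumes "rational_on S f" "rational_on S g"
  shows "rational_on S (\<lambda>x. f x + g x)"
proof -
  obtain p q r s where "q \<noteq> 0" "\<forall>x\<in>S. poly q x \<noteq> 0 \<and> f x = poly p x / poly q x"
    "s \<noteq> 0" "\<forall>x\<in>S. poly s x \<noteq> 0 \<and> g x = poly r x / poly s x"
    using assms unfolding rational_on_def by metis
  then show ?thesis
    unfolding rational_on_def
    by (intro exI[of _ "p * s + r * q"] exI[of _ "q * s"]) (simp add: field_simps)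
qed

lemma rational_on_uminus [rational_intros]:
  "rational_on S f \<Longrightarrow> rational_on S (\<lambda>x. - f x)"
  using rational_on_mult[OF rational_on_const[of S "- 1"]] by simp

lemma rational_on_diff [rational_intros]:
  "rational_on S f \<Longrightarrow> rational_on S g \<Longrightarrow> rational_on S (\<lambda>x. f x - g x)"
  using rational_on_add[OF _ rational_on_uminus] by simp

lemma rational_on_divide_const [rational_intros]:
  "rational_on S f \<Longrightarrow> rational_on S (\<lambda>x. f x / b)"
  using rational_on_mult[OF _ rational_on_const[of S "1 / b"]] by simp

lemma rational_on_divide:
  assumes "rational_on S f" "rational_on S g" "\<forall>x\<in>S. g x \<noteq> 0"
  shows "rational_on S (\<lambda>x. f x / g x)"
\<comment> \<open>The numerator r of g becomes part of the new denominator and must be a nonzero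
  polynomial; a point of S guarantees this.\<close>
proof (cases "S = {}")
  case True
  then show ?thesis unfolding rational_on_def by (intro exI[of _ 1]) simp
next
  case False
  obtain p q r s where pq: "q \<noteq> 0" "\<forall>x\<in>S. poly q x \<noteq> 0 \<and> f x = poly p x / poly q x"
    and rs: "s \<noteq> 0" "\<forall>x\<in>S. poly s x \<noteq> 0 \<and> g x = poly r x / poly s x"
    using assms(1,2) unfolding rational_on_def by metis
  have r: "\<forall>x\<in>S. poly r x \<noteq> 0" using rs(2) assms(3) by fastforce
  with False have "r \<noteq> 0" by auto
  with pq rs r show ?thesis
    unfolding rational_on_def by (intro exI[of _ "p * s"] exI[of _ "q * r"]) simp
qed

text \<open>Zeros of f in S are roots of its numerator p. As S contains all large x, p = 0 would
  make f eventually 0, against the nonzero limit.\<close>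

lemma rational_on_finite_zeros:
  assumes f: "rational_on S f" and S: "finite (- S)" and lim: "(f \<longlongrightarrow> l) at_top" "l \<noteq> 0"
  shows "finite {x \<in> S. f x = 0}"
proof -
  obtain p q where pq: "\<forall>x\<in>S. poly q x \<noteq> 0 \<and> f x = poly p x / poly q x"
    using f unfolding rational_on_def by metis
  have "p \<noteq> 0"
  proof
    assume "p = 0"
    have "eventually (\<lambda>x. x > Max (insert 0 (- S))) at_top" by (rule eventually_gt_at_top)
    then have "eventually (\<lambda>x. f x = 0) at_top"
    proof eventually_elim
      case (elim x)
      then have "x \<in> S" using S by (metis ComplI Max_ge finite_insert insertI2 not_le)
      then show ?case using pq \<open>p = 0\<close> by simp
    qed
    then have "(f \<longlongrightarrow> 0) at_top" by (rule tendsto_eventually)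
    then show False using lim tendsto_unique[OF trivial_limit_at_top_linorder] by blast
  qed
  then show ?thesis
    by (rule finite_subset[OF _ poly_roots_finite, rotated]) (use pq in auto)
qed

text \<open>Stated along a function g because the coefficients evaluate \<open>A1\<close> both at x
  and at x + 1.\<close>

lemma rational_on_A1 [rational_intros]:
  assumes "rational_on S g" "\<forall>x\<in>S. g x \<notin> {c, c + 1}"
  shows "rational_on S (\<lambda>x. A1 a lam c Q (g x) n)"
  unfolding A1_def
  by (intro rational_intros rational_on_divide assms(1)) (use assms(2) in force)

lemma rational_on_B1 [rational_intros]:
  assumes "rational_on S g" "\<forall>x\<in>S. g x \<notin> {c, c + 1}"
  shows "rational_on S (\<lambda>x. B1 a lam c Q (g x) n)"
  unfolding B1_def
  by (intro rational_intros rational_on_divide assms(1)) (use assms(2) in force)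

context
  fixes S :: "real set" and c :: real
  assumes S: "S \<inter> {c - 1, c, c + 1} = {}"
begin

lemma shift_avoids_poles: "\<forall>x\<in>S. x \<notin> {c, c + 1}" "\<forall>x\<in>S. x + 1 \<notin> {c, c + 1}"
  using S by auto

lemma rational_on_C1: "rational_on S (\<lambda>x. C1 a lam c Q x n)"
  and rational_on_D1: "rational_on S (\<lambda>x. D1 a lam c Q x n)"
  and rational_on_A2: "rational_on S (\<lambda>x. A2 a lam c Q x n)"
  and rational_on_B2: "rational_on S (\<lambda>x. B2 a lam c Q x n)"
  and rational_on_C2: "rational_on S (\<lambda>x. C2 a lam c Q x n)"
  and rational_on_D2: "rational_on S (\<lambda>x. D2 a lam c Q x n)"
  unfolding C1_def D1_def A2_def B2_def C2_def D2_def
  by (intro rational_intros shift_avoids_poles)+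

lemmas rational_on_coeffs = rational_on_C1 rational_on_D1 rational_on_A2 rational_on_B2
  rational_on_C2 rational_on_D2

lemma rational_on_Lam: "rational_on S (\<lambda>x. Lam a lam c Q x n)"
  unfolding Lam_def by (intro rational_intros rational_on_coeffs shift_avoids_poles)

lemma rational_on_Xi_Theta:
  assumes "\<forall>x\<in>S. Lam a lam c Q x n \<noteq> 0"
  shows "rational_on S (\<lambda>x. Xi1 a lam c Q x n)" "rational_on S (\<lambda>x. Xi2 a lam c Q x n)"
    "rational_on S (\<lambda>x. Theta1 a lam c Q x n)" "rational_on S (\<lambda>x. Theta2 a lam c Q x n)"
  unfolding Xi1_def Xi2_def Theta1_def Theta2_def
  by (intro rational_on_divide rational_on_Lam rational_intros rational_on_coeffs shift_avoids_poles assms)+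

end

lemma rational_on_rec:
  shows "rational_on (rec_domain a lam c Q n) (\<lambda>x. rec_beta a lam c Q x n)"
    and "rational_on (rec_domain a lam c Q n) (\<lambda>x. rec_gamma a lam c Q x n)"
proof -
  let ?S = "rec_domain a lam c Q n"
  have S: "?S \<inter> {c - 1, c, c + 1} = {}"
    and L: "\<forall>x\<in>?S. Lam a lam c Q x n \<noteq> 0" "\<forall>x\<in>?S. Lam a lam c Q x (n + 1) \<noteq> 0"
    and T: "\<forall>x\<in>?S. Theta2 a lam c Q x (n + 1) \<noteq> 0"
    by (auto simp: rec_domain_def)
  show "rational_on ?S (\<lambda>x. rec_beta a lam c Q x n)" "rational_on ?S (\<lambda>x. rec_gamma a lam c Q x n)"
    unfolding rec_beta_def rec_gamma_def
    by (intro rational_on_divide rational_on_add rational_on_uminus rational_on_Xi_Theta[OF S] L T)+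
qed

section \<open>Limits of the coefficients at infinity\<close>

lemma
  fixes u v c d :: real
  shows linear_over_quadratic_tendsto: "((\<lambda>x. (u + (x - c) * v) / ((x - c) * (x - c - 1))) \<longlongrightarrow> 0) at_top"
    and mult_linear_over_quadratic_tendsto:
      "((\<lambda>x. (x + d) * ((u + (x - c) * v) / ((x - c) * (x - c - 1)))) \<longlongrightarrow> v) at_top"
proof -
  \<comment> \<open>Separates the contributions of u and v, each with an elementary limit; used with
    t = 1 and with t = x + d.\<close>
  have split: "u * (t / (A * B)) + v * (t / B) = t * ((u + A * v) / (A * B))"
    if "A \<noteq> 0" "B \<noteq> 0" for A B t :: real
    using that by (simp add: field_simps)
  let ?f = "\<lambda>x. u * (1 / ((x - c) * (x - c - 1))) + v * (1 / (x - c - 1))"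
  have eq: "eventually (\<lambda>x. ?f x = (u + (x - c) * v) / ((x - c) * (x - c - 1))) at_top"
    using eventually_gt_at_top[of "c + 1"] by eventually_elim (simp add: split[of _ _ 1, simplified])
  have "(?f \<longlongrightarrow> u * 0 + v * 0) at_top"
    by (intro tendsto_intros; real_asymp)
  from Lim_transform_eventually[OF this eq] show "((\<lambda>x. (u + (x - c) * v) / ((x - c) * (x - c - 1))) \<longlongrightarrow> 0) at_top"
    by simp
  let ?g = "\<lambda>x. u * ((x + d) / ((x - c) * (x - c - 1))) + v * ((x + d) / (x - c - 1))"
  have eq: "eventually (\<lambda>x. ?g x = (x + d) * ((u + (x - c) * v) / ((x - c) * (x - c - 1)))) at_top"
    using eventually_gt_at_top[of "c + 1"] by eventually_elim (rule split; simp)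
  have "(?g \<longlongrightarrow> u * 0 + v * 1) at_top"
    by (intro tendsto_intros; real_asymp)
  from Lim_transform_eventually[OF this eq] show "((\<lambda>x. (x + d) * ((u + (x - c) * v) / ((x - c) * (x - c - 1)))) \<longlongrightarrow> v) at_top"
    by simp
qed

context
  fixes a lam c :: real and Q :: "nat \<Rightarrow> real poly"
begin

text \<open>The limit of x times \<open>B1\<close> at infinity; it appears wherever
  \<open>B1\<close> meets a factor linear in x.\<close>

abbreviation kappa :: "nat \<Rightarrow> real" where
  "kappa n \<equiv> conn_factor a lam c Q n * fwd_diff (poly (charlier a n)) c"

lemma A1_tendsto: "((\<lambda>x. A1 a lam c Q x n) \<longlongrightarrow> 1) at_top"
  unfolding A1_def by (rule tendsto_eq_intros linear_over_quadratic_tendsto refl | simp)+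

lemma B1_tendsto: "((\<lambda>x. B1 a lam c Q x n) \<longlongrightarrow> 0) at_top"
  unfolding B1_def by (rule tendsto_eq_intros linear_over_quadratic_tendsto refl | simp)+

lemma mult_B1_tendsto: "((\<lambda>x. (x + d) * B1 a lam c Q x n) \<longlongrightarrow> kappa n) at_top"
  using tendsto_mult[OF tendsto_const[of "conn_factor a lam c Q n"] mult_linear_over_quadratic_tendsto]
  unfolding B1_def by (simp add: mult.left_commute del: charlier.simps)

lemma filterlim_add_one_at_top: "filterlim (\<lambda>x::real. x + 1) at_top at_top"
  by real_asymp

lemmas A1_shift_tendsto = filterlim_compose[OF A1_tendsto filterlim_add_one_at_top]
lemmas B1_shift_tendsto = filterlim_compose[OF B1_tendsto filterlim_add_one_at_top]

lemma mult_B1_shift_tendsto: "((\<lambda>x. (x + d) * B1 a lam c Q (x + 1) n) \<longlongrightarrow> kappa n) at_top"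
  using filterlim_compose[OF mult_B1_tendsto[of "d - 1"] filterlim_add_one_at_top] by (simp add: algebra_simps)

lemma A2_tendsto: "((\<lambda>x. A2 a lam c Q x (Suc n)) \<longlongrightarrow> 0) at_top"
  unfolding A2_def
  using tendsto_mult[OF tendsto_const[of "- 1 / (a * real n)"] B1_tendsto[of n]] by simp

text \<open>Although \<open>B1\<close> tends to 0, its product with x - n - a survives and
  contributes the term with \<open>kappa n\<close>.\<close>

lemma B2_tendsto: "((\<lambda>x. B2 a lam c Q x (Suc n)) \<longlongrightarrow> 1 + kappa n / (a * real n)) at_top"
proof -
  have "B2 a lam c Q x (Suc n) = A1 a lam c Q x n
      + 1 / (a * real n) * ((x + (- real n - a)) * B1 a lam c Q x n)" for x
    by (simp add: B2_Suc)
  then show ?thesis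
    using tendsto_add[OF A1_tendsto[of n] tendsto_mult[OF tendsto_const[of "1 / (a * real n)"]
          mult_B1_tendsto[of "- real n - a" n]]]
    by simp
qed

text \<open>For \<open>n = 0\<close> the convention \<open>x / 0 = 0\<close> makes the limit \<open>1\<close>, which is the correct value.\<close>

lemma Lam_tendsto: "((\<lambda>x. Lam a lam c Q x (Suc n)) \<longlongrightarrow> 1 + kappa n / (a * real n)) at_top"
  unfolding Lam_def
  using tendsto_diff[OF tendsto_mult[OF A1_tendsto B2_tendsto] tendsto_mult[OF B1_tendsto A2_tendsto]]
  by simp

lemma C1_tendsto: "((\<lambda>x. C1 a lam c Q x n) \<longlongrightarrow> 0) at_top"
  unfolding C1_def
  using tendsto_diff[OF tendsto_diff[OF A1_shift_tendsto A1_tendsto]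
      tendsto_mult[OF tendsto_const[of "1 / a"] B1_shift_tendsto]]
  by simp

lemma D1_tendsto: "((\<lambda>x. D1 a lam c Q x n) \<longlongrightarrow> real n + kappa n / a) at_top"
proof -
  have "D1 a lam c Q x n = real n * A1 a lam c Q (x + 1) n - B1 a lam c Q x n
      + 1 / a * ((x + (1 - real n)) * B1 a lam c Q (x + 1) n)" for x
    by (simp add: D1_def algebra_simps add_divide_distrib diff_divide_distrib)
  then show ?thesis
    using tendsto_add[OF tendsto_diff[OF tendsto_mult[OF tendsto_const[of "real n"]
            A1_shift_tendsto[of n]] B1_tendsto[of n]]
          tendsto_mult[OF tendsto_const[of "1 / a"] mult_B1_shift_tendsto[of "1 - real n" n]]]
    by simp
qed

lemma Theta2_numerator_tendsto:
  "((\<lambda>x. A1 a lam c Q x n * D1 a lam c Q x n - B1 a lam c Q x n * C1 a lam c Q x n)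
     \<longlongrightarrow> real n + kappa n / a) at_top"
  using tendsto_diff[OF tendsto_mult[OF A1_tendsto D1_tendsto] tendsto_mult[OF B1_tendsto C1_tendsto]]
  by simp

text \<open>When the coefficients numbered 2 are rewritten through those numbered 1, the two
  products containing x - n - a cancel.\<close>

lemma Theta2_Suc:
  assumes "a > 0" "n \<ge> 1"
  shows "Theta2 a lam c Q x (Suc n) =
    - (A1 a lam c Q x n * D1 a lam c Q x n - B1 a lam c Q x n * C1 a lam c Q x n)
      / (a * real n * Lam a lam c Q x (Suc n))"
proof -
  have "C2 a lam c Q x (Suc n) * B2 a lam c Q x (Suc n) - A2 a lam c Q x (Suc n) * D2 a lam c Q x (Suc n)
    = - (A1 a lam c Q x n * D1 a lam c Q x n - B1 a lam c Q x n * C1 a lam c Q x n) / (a * real n)"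
    unfolding A2_Suc B2_Suc C2_Suc[OF assms] D2_Suc[OF assms]
    using assms by (simp add: field_simps)
  then show ?thesis by (simp add: Theta2_def)
qed

end

section \<open>Finiteness of the excluded set\<close>

lemma finite_compl_rec_domain:
  assumes "a > 0" "lam \<ge> 0" "monic_orthogonal (sobolev_ip a lam c) Q" "n \<ge> 1"
  shows "finite (- rec_domain a lam c Q n)"
proof -
  let ?S = "- {c - 1, c, c + 1}"
  let ?E = "\<lambda>x. A1 a lam c Q x n * D1 a lam c Q x n - B1 a lam c Q x n * C1 a lam c Q x n"
  have S: "?S \<inter> {c - 1, c, c + 1} = {}" by auto
  have fin: "finite (- ?S)" by simp
  note kappa = conn_factor_sign[OF assms(1-3)]
  \<comment> \<open>Needed for m = n - 1 and m = n. For m = 0 the quotient by 0 is 0, so the limit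
    is 1.\<close>
  have Lam: "finite {x \<in> ?S. Lam a lam c Q x (Suc m) = 0}" for m
  proof (rule rational_on_finite_zeros[OF rational_on_Lam[OF S] fin Lam_tendsto])
    show "1 + kappa a lam c Q m / (a * real m) \<noteq> 0"
      using kappa[of m] assms(1) by (smt (verit) divide_nonneg_nonneg mult_nonneg_nonneg of_nat_0_le_iff)
  qed
  have "finite {x \<in> ?S. ?E x = 0}"
  proof (rule rational_on_finite_zeros[OF _ fin Theta2_numerator_tendsto])
    show "rational_on ?S ?E"
      by (intro rational_intros rational_on_coeffs[OF S] shift_avoids_poles[OF S])
    \<comment> \<open>The sum is at least 1, since n \<ge> 1 and kappa_n \<ge> 0.\<close>
    show "real n + kappa a lam c Q n / a \<noteq> 0"
      using kappa[of n] assms(1,4) by (smt (verit) divide_nonneg_nonneg of_nat_1 of_nat_mono)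
  qed
  with Lam[of "n - 1"] Lam[of n]
  have "finite ({c - 1, c, c + 1} \<union> {x \<in> ?S. Lam a lam c Q x n = 0}
      \<union> {x \<in> ?S. Lam a lam c Q x (Suc n) = 0} \<union> {x \<in> ?S. ?E x = 0})"
    using assms(4) by simp
  \<comment> \<open>Where \<open>Lam\<close> at n + 1 is nonzero, \<open>Theta2\<close> at n + 1
    vanishes only at zeros of \<open>?E\<close>.\<close>
  moreover have "- rec_domain a lam c Q n \<subseteq> {c - 1, c, c + 1} \<union> {x \<in> ?S. Lam a lam c Q x n = 0}
      \<union> {x \<in> ?S. Lam a lam c Q x (Suc n) = 0} \<union> {x \<in> ?S. ?E x = 0}"
    using assms(1,4) by (auto simp: rec_domain_def Theta2_Suc)
  ultimately show ?thesis by (rule finite_subset[rotated])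
qed

theorem mainTheorem6:
  fixes a lam c :: real and Q :: "nat \<Rightarrow> real poly" and n :: nat
  assumes "a > 0" and "lam \<ge> 0"
    and "\<forall>k::nat. real k \<notin> {c<..<c + 1}"
    and "monic_orthogonal (sobolev_ip a lam c) Q"
    and "n \<ge> 1"
  shows "finite (- rec_domain a lam c Q n)
    \<and> rational_on (rec_domain a lam c Q n) (\<lambda>x. rec_beta a lam c Q x n)
    \<and> rational_on (rec_domain a lam c Q n) (\<lambda>x. rec_gamma a lam c Q x n)
    \<and> (\<forall>x \<in> rec_domain a lam c Q n.
          poly (Q (n + 1)) x =
            rec_beta a lam c Q x n * poly (Q n) x + rec_gamma a lam c Q x n * poly (Q (n - 1)) x)"
  using finite_compl_rec_domain[OF assms(1,2,4,5)] rational_on_rec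
    three_term_recurrence[OF assms(1,2,4,5)]
  by blast

end
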